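(* Let the random variables $X_1,\ldots,X_n$ be independent and such that $0\le X_i\le 1$ for each $i=1,\ldots,n$. Set $p=\frac{1}{n}\sum_{i=1}^n\mathbb{E}[X_i]$, fix a real number $t$ such that $np<t<n$, and let $B\sim\mathrm{Bin}(n,p)$. Let $\phi\in\mathcal{F}_{ic}(t)$ be such that $T_n(\phi,t)=\inf_f T_n(f,t)$, where the infimum is taken over all functions $f\in\mathcal{F}_{ic}(t)$. Then $\phi(x)$ equals $\max\left\{0,\frac{1}{t-\varepsilon}\cdot(x-\varepsilon)\right\}$, for some $\varepsilon\in[0,t)$.
   Context: $\mathrm{Bin}(n,p)$ denotes the binomial distribution with parameters $n$ and $p$. For fixed $t>0$, $\mathcal{F}_{ic}(t)$ is the set of all convex functions $f:[0,\infty)\to[0,\infty)$ that are increasing in the interval $[t,\infty)$. For $f\in\mathcal{F}_{ic}(t)$, $$T_n(f,t):=\frac{1}{f(t)}\mathbb{E}[f(B)]=\frac{1}{f(t)}\sum_{i=0}^n f(i)\cdot\mathbb{P}[B=i].$$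
   Formalization: The equality holds up to the factor φ(t), with f(t)>0 required, and only for x in [0,n]; for p=0 only on the support of B; if ε is not an integer, the open unit interval between integers around ε is excepted. The literal claim fails, e.g. for 2φ. *)

theory Defs
  imports "HOL-Probability.Probability"
begin

text \<open>Functions on the half-line \<open>[0, \<infinity>)\<close> are total functions on the reals of which only the
  values at nonnegative arguments matter. "Increasing" is meant weakly.\<close>

definition F_ic :: "real \<Rightarrow> (real \<Rightarrow> real) set" where
  "F_ic t = {f. (\<forall>x\<ge>0. 0 \<le> f x) \<and> convex_on {0..} f \<and> mono_on {t..} f}"

definition T_n :: "nat \<Rightarrow> real \<Rightarrow> (real \<Rightarrow> real) \<Rightarrow> real \<Rightarrow> real" where
  "T_n n p f t = 1 / f t * measure_pmf.expectation (binomial_pmf n p) (\<lambda>i. f (real i))"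

text \<open>The quotient \<open>T_n n p f t\<close> is meaningful only if \<open>f t \<noteq> 0\<close>; without this side condition the
  zero function would be a minimizer, because division by zero yields zero.\<close>

definition T_minimizer :: "nat \<Rightarrow> real \<Rightarrow> real \<Rightarrow> (real \<Rightarrow> real) \<Rightarrow> bool" where
  "T_minimizer n p t f \<longleftrightarrow>
     f \<in> F_ic t \<and> 0 < f t \<and> T_n n p f t = (INF g\<in>{g \<in> F_ic t. 0 < g t}. T_n n p g t)"

definition hinge :: "real \<Rightarrow> real \<Rightarrow> real \<Rightarrow> real" where
  "hinge t \<epsilon> x = max 0 (1 / (t - \<epsilon>) * (x - \<epsilon>))"

end

theory Submission
  imports Defs
begin

text \<open>
  The proof compares the minimizer \<open>\<phi>\<close> with a supporting line at \<open>t\<close>. By convexity there is a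
  slope \<open>s\<close> such that \<open>\<phi> x \<ge> \<phi> t + s * (x - t)\<close> for all \<open>x \<ge> 0\<close>.

  If \<open>s < \<phi> t / t\<close>, the line is positive at \<open>0\<close>. Taking expectations, where the binomial mean
  \<open>n * p\<close> lies strictly to the left of \<open>t\<close>, shows that \<open>\<phi>\<close> has strictly larger quotient than the
  line \<open>x / t\<close> through the origin, which is \<open>hinge t 0\<close>. So a minimizer has \<open>s \<ge> \<phi> t / t\<close>, and the
  supporting line vanishes at some \<open>\<epsilon> \<in> [0, t)\<close>.

  Since \<open>\<phi> \<ge> 0\<close> as well, \<open>\<phi>\<close> dominates \<open>\<phi> t * hinge t \<epsilon>\<close>, the positive part of the line, and agrees
  with it at \<open>t\<close>. Domination gives one inequality between the quotients and minimality the other, so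
  the hinge is a minimizer too, and \<open>\<phi>\<close> and \<open>\<phi> t * hinge t \<epsilon>\<close> have the same expectation. A nonnegative
  difference with expectation zero vanishes on the support, which is \<open>{0..n}\<close> for \<open>0 < p < 1\<close>.

  Between integers, convexity bounds \<open>\<phi>\<close> by its chords. On \<open>[0, \<lfloor>\<epsilon>\<rfloor>]\<close> and on \<open>[\<lceil>\<epsilon>\<rceil>, n]\<close> the hinge is
  affine, hence equal to the chord of \<open>\<phi>\<close> there, and the upper bound meets the lower one. In a cell
  with \<open>\<epsilon>\<close> in its interior the hinge has its kink strictly below the chord, so the two bounds do not
  meet there.
\<close>

lemma hinge_at: "\<epsilon> < t \<Longrightarrow> hinge t \<epsilon> t = 1"
  by (simp add: hinge_def)

lemma hinge_left: "\<epsilon> < t \<Longrightarrow> x \<le> \<epsilon> \<Longrightarrow> hinge t \<epsilon> x = 0"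
  by (simp add: hinge_def divide_le_0_iff)

lemma hinge_right: "\<epsilon> < t \<Longrightarrow> \<epsilon> \<le> x \<Longrightarrow> hinge t \<epsilon> x = (x - \<epsilon>) / (t - \<epsilon>)"
  by (simp add: hinge_def)

lemma hinge_in_F_ic:
  assumes "\<epsilon> < t"
  shows "hinge t \<epsilon> \<in> F_ic t"
proof -
  have pos: "0 \<le> 1 / (t - \<epsilon>)"
    using assms by simp
  have "convex_on {0..} (hinge t \<epsilon>)"
  proof (rule convex_onI)
    fix u x y :: real
    assume u: "0 < u" "u < 1"
    let ?l = "\<lambda>x. 1 / (t - \<epsilon>) * (x - \<epsilon>)"
    have "(1 - u) * ?l x \<le> (1 - u) * hinge t \<epsilon> x" "u * ?l y \<le> u * hinge t \<epsilon> y"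
         "0 \<le> (1 - u) * hinge t \<epsilon> x" "0 \<le> u * hinge t \<epsilon> y"
      unfolding hinge_def using u by (intro mult_left_mono mult_nonneg_nonneg; simp)+
    moreover have "?l ((1 - u) *\<^sub>R x + u *\<^sub>R y) = (1 - u) * ?l x + u * ?l y"
      using assms by (simp add: divide_simps) (simp add: algebra_simps)
    ultimately show "hinge t \<epsilon> ((1 - u) *\<^sub>R x + u *\<^sub>R y) \<le> (1 - u) * hinge t \<epsilon> x + u * hinge t \<epsilon> y"
      unfolding hinge_def[of t \<epsilon> "(1 - u) *\<^sub>R x + u *\<^sub>R y"] by linarith
  qed simp
  moreover have "mono_on {t..} (hinge t \<epsilon>)"
    unfolding hinge_def using pos by (intro mono_onI max.mono mult_left_mono) auto
  ultimately show ?thesis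
    by (simp add: F_ic_def hinge_def)
qed

text \<open>The infimum of \<open>T_n\<close> is a conditional one over the reals; it is a genuine lower bound because
  all quotients are nonnegative.\<close>

lemma T_minimizer_le:
  assumes "T_minimizer n p t f" "g \<in> F_ic t" "0 < g t"
  shows "T_n n p f t \<le> T_n n p g t"
proof -
  have "0 \<le> T_n n p g t" if "g \<in> F_ic t" "0 < g t" for g
    using that by (simp add: T_n_def F_ic_def)
  then have "bdd_below ((\<lambda>g. T_n n p g t) ` {g \<in> F_ic t. 0 < g t})"
    by (intro bdd_belowI[of _ 0]) blast
  then show ?thesis
    using assms by (simp add: T_minimizer_def) (rule cINF_lower; simp)
qed

lemma T_minimizer_if_le:
  assumes "T_minimizer n p t f" "g \<in> F_ic t" "0 < g t" "T_n n p g t \<le> T_n n p f t"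
  shows "T_minimizer n p t g"
  using assms T_minimizer_le[OF assms(1-3)] by (simp add: T_minimizer_def)

lemma supporting_line_at_interior:
  fixes f :: "real \<Rightarrow> real"
  assumes "convex_on {0..} f" "0 < t"
  obtains s where "\<And>x. 0 \<le> x \<Longrightarrow> f t + s * (x - t) \<le> f x"
  using convex_le_Inf_differential[OF assms(1), of t] assms(2) by auto

text \<open>The mean of the binomial distribution is the first moment of the Bernstein polynomials.\<close>

lemma expectation_affine_binomial_pmf:
  assumes "p \<in> {0..1}"
  shows "measure_pmf.expectation (binomial_pmf n p) (\<lambda>i. a + s * (real i - t)) = a + s * (real n * p - t)"
proof -
  have "measure_pmf.expectation (binomial_pmf n p) real = (\<Sum>k\<le>n. real k * Bernstein n k p)"
    using assms by (simp add: expectation_binomial_pmf' Bernstein_def mult.commute)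
  then show ?thesis
    using assms by simp
qed

lemma T_n_hinge_zero:
  assumes "p \<in> {0..1}" "0 < t"
  shows "T_n n p (hinge t 0) t = real n * p / t"
proof -
  have "(\<lambda>i. hinge t 0 (real i)) = (\<lambda>i. 0 + 1 / t * (real i - 0))"
    using assms(2) by (simp add: fun_eq_iff hinge_def)
  then show ?thesis
    unfolding T_n_def hinge_at[OF assms(2)] by (simp only: expectation_affine_binomial_pmf[OF assms(1)]) simp
qed

text \<open>A flatter supporting line would be beaten by the line through the origin, since the mean lies
  to the left of the contact point \<open>t\<close>.\<close>

lemma supporting_slope_of_minimizer:
  assumes p: "p \<in> {0..1}" and t: "0 < t" "real n * p < t"
    and min: "T_minimizer n p t f"
    and line: "\<And>x. 0 \<le> x \<Longrightarrow> f t + s * (x - t) \<le> f x"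
  shows "f t / t \<le> s"
proof (rule ccontr)
  assume "\<not> f t / t \<le> s"
  \<comment> \<open>The factor \<open>n * p - t\<close> is negative, so a smaller slope gives a larger value at the mean.\<close>
  then have "f t / t * (real n * p - t) < s * (real n * p - t)"
    using t by (intro mult_strict_right_mono_neg) auto
  then have "f t * (real n * p / t) < f t + s * (real n * p - t)"
    using t(1) by (simp add: field_simps)
  also have "\<dots> \<le> measure_pmf.expectation (binomial_pmf n p) (\<lambda>i. f (real i))"
    unfolding expectation_affine_binomial_pmf[OF p, symmetric]
    using p line by (intro integral_mono) auto
  finally have "f t * (real n * p / t) < measure_pmf.expectation (binomial_pmf n p) (\<lambda>i. f (real i))" .
  moreover have "0 < f t"
    using min by (simp add: T_minimizer_def)
  ultimately have "real n * p / t < T_n n p f t"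
    by (simp add: T_n_def field_simps)
  moreover have "T_n n p f t \<le> T_n n p (hinge t 0) t"
    using min t(1) by (intro T_minimizer_le hinge_in_F_ic) (auto simp: hinge_at)
  ultimately show False
    using T_n_hinge_zero[OF p t(1)] by simp
qed

text \<open>The line through \<open>(t, c)\<close> with slope \<open>s\<close> crosses zero at \<open>t - c / s\<close>, and its positive part is a
  multiple of the hinge with that kink.\<close>

lemma scaled_hinge_le_of_supporting_line:
  assumes "0 < c" "0 < s" "0 \<le> y" "c + s * (x - t) \<le> y"
  shows "c * hinge t (t - c / s) x \<le> y"
proof -
  have "c * (1 / (t - (t - c / s)) * (x - (t - c / s))) = c + s * (x - t)"
    using assms(1,2) by (simp add: field_simps)
  then show ?thesis
    using assms unfolding hinge_def by (auto simp: max_def)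
qed

lemma minimizer_dominates_hinge:
  assumes p: "p \<in> {0..1}" and t: "0 < t" "real n * p < t"
    and min: "T_minimizer n p t f"
  obtains \<epsilon> where "\<epsilon> \<in> {0..<t}" "\<And>x. 0 \<le> x \<Longrightarrow> f t * hinge t \<epsilon> x \<le> f x"
proof -
  have f: "\<And>x. 0 \<le> x \<Longrightarrow> 0 \<le> f x" "convex_on {0..} f" "0 < f t"
    using min by (auto simp: T_minimizer_def F_ic_def)
  obtain s where line: "\<And>x. 0 \<le> x \<Longrightarrow> f t + s * (x - t) \<le> f x"
    using supporting_line_at_interior[OF f(2) t(1)] by blast
  have slope: "f t / t \<le> s"
    by (rule supporting_slope_of_minimizer[OF p t min line])
  moreover have "0 < f t / t"
    using f(3) t(1) by simp
  ultimately have s: "0 < s"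
    by linarith
  show thesis
  proof (rule that[of "t - f t / s"])
    show "t - f t / s \<in> {0..<t}"
      using slope s t(1) f(3) by (simp add: field_simps)
    show "f t * hinge t (t - f t / s) x \<le> f x" if "0 \<le> x" for x
      using that f s line by (intro scaled_hinge_le_of_supporting_line) auto
  qed
qed

text \<open>Minimality turns domination into equality of expectations, and a nonnegative difference
  with expectation zero vanishes on the support.\<close>

lemma minimizer_eq_dominated_on_support:
  assumes p: "p \<in> {0..1}" and min: "T_minimizer n p t f"
    and g: "g \<in> F_ic t" "g t = 1"
    and dom: "\<And>x. 0 \<le> x \<Longrightarrow> f t * g x \<le> f x"
  shows "T_minimizer n p t g"
    and "\<And>i. i \<in> set_pmf (binomial_pmf n p) \<Longrightarrow> f (real i) = f t * g (real i)"
proof -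
  let ?E = "measure_pmf.expectation (binomial_pmf n p)"
  have ft: "0 < f t"
    using min by (simp add: T_minimizer_def)
  have "f t * ?E (\<lambda>i. g (real i)) = ?E (\<lambda>i. f t * g (real i))"
    by simp
  also have "\<dots> \<le> ?E (\<lambda>i. f (real i))"
    using p dom by (intro integral_mono) auto
  finally have le: "f t * ?E (\<lambda>i. g (real i)) \<le> ?E (\<lambda>i. f (real i))" .
  then have T_le: "T_n n p g t \<le> T_n n p f t"
    using ft g(2) by (simp add: T_n_def field_simps)
  then show "T_minimizer n p t g"
    using min g by (intro T_minimizer_if_le[OF min]) auto
  have "T_n n p f t \<le> T_n n p g t"
    using min g by (intro T_minimizer_le) auto
  then have "?E (\<lambda>i. f (real i)) \<le> f t * ?E (\<lambda>i. g (real i))"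
    using ft g(2) by (simp add: T_n_def field_simps)
  with le have "?E (\<lambda>i. f (real i) - f t * g (real i)) = 0"
    using p by simp
  then have "AE i in measure_pmf (binomial_pmf n p). f (real i) - f t * g (real i) = 0"
    using p dom by (subst (asm) integral_nonneg_eq_0_iff_AE) auto
  then show "f (real i) = f t * g (real i)" if "i \<in> set_pmf (binomial_pmf n p)" for i
    using that by (simp add: AE_measure_pmf_iff)
qed

lemma convex_eq_affine_if_above:
  fixes f :: "real \<Rightarrow> real"
  assumes "convex_on S f" "{a..b} \<subseteq> S" "x \<in> {a..b}"
    and "f a = A + K * a" "f b = A + K * b" "A + K * x \<le> f x"
  shows "f x = A + K * x"
proof (cases "a = b")
  case False
  then have ab: "a < b"
    using assms(3) by auto
  obtain u where u: "0 \<le> u" "u \<le> 1" and x: "x = (1 - u) *\<^sub>R a + u *\<^sub>R b"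
  proof (rule that[of "(x - a) / (b - a)"])
    have "(x - a) / (b - a) * (b - a) = x - a"
      using ab by simp
    then show "x = (1 - (x - a) / (b - a)) *\<^sub>R a + ((x - a) / (b - a)) *\<^sub>R b"
      by (simp only: real_scaleR_def left_diff_distrib right_diff_distrib)
  qed (use ab assms(3) in auto)
  have "f ((1 - u) *\<^sub>R a + u *\<^sub>R b) \<le> (1 - u) * f a + u * f b"
    using assms(2) ab u by (intro convex_onD[OF assms(1)]) auto
  also have "\<dots> = A + K * ((1 - u) *\<^sub>R a + u *\<^sub>R b)"
    unfolding assms(4,5) by (simp add: algebra_simps)
  finally show ?thesis
    unfolding x[symmetric] using assms(6) by simp
qed (use assms in auto)

text \<open>Away from the cell with the kink, the hinge is affine between integers at which it agrees
  with \<open>f\<close>, so the chord bound applies.\<close>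

lemma eq_scaled_hinge_off_kink:
  assumes conv: "convex_on {0..} f" and \<epsilon>: "\<epsilon> \<in> {0..<t}" and t: "t < real n"
    and dom: "\<And>x. 0 \<le> x \<Longrightarrow> c * hinge t \<epsilon> x \<le> f x"
    and eq: "\<And>i. i \<le> n \<Longrightarrow> f (real i) = c * hinge t \<epsilon> (real i)"
    and x: "x \<in> {0..real n} - {of_int \<lfloor>\<epsilon>\<rfloor><..<of_int \<lceil>\<epsilon>\<rceil>}"
  shows "f x = c * hinge t \<epsilon> x"
proof -
  have \<epsilon>t: "\<epsilon> < t"
    using \<epsilon> by simp
  consider "x \<in> {real 0..real (nat \<lfloor>\<epsilon>\<rfloor>)}" | "x \<in> {real (nat \<lceil>\<epsilon>\<rceil>)..real n}"
    using x \<epsilon> by (force simp: not_less)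
  then show ?thesis
  proof cases
    case 1
    have fl: "real (nat \<lfloor>\<epsilon>\<rfloor>) \<le> \<epsilon>"
      using \<epsilon> by simp
    then have x\<epsilon>: "x \<le> \<epsilon>"
      using 1 unfolding atLeastAtMost_iff by linarith
    from fl have "nat \<lfloor>\<epsilon>\<rfloor> \<le> n"
      using \<epsilon>t t by linarith
    then have "f x = 0 + 0 * x"
      using 1 fl dom[of x] eq[of 0] eq[of "nat \<lfloor>\<epsilon>\<rfloor>"] \<epsilon>
      by (intro convex_eq_affine_if_above[OF conv _ 1]) (auto simp: hinge_left)
    then show ?thesis
      using \<epsilon>t x\<epsilon> by (simp add: hinge_left)
  next
    case 2
    have ce: "\<epsilon> \<le> real (nat \<lceil>\<epsilon>\<rceil>)"
      by linarith
    have cn: "nat \<lceil>\<epsilon>\<rceil> \<le> n"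
      using \<epsilon>t t by (simp add: ceiling_le_iff)
    have affine: "c * hinge t \<epsilon> y = - c * \<epsilon> / (t - \<epsilon>) + c / (t - \<epsilon>) * y" if "\<epsilon> \<le> y" for y
      using that \<epsilon>t by (simp add: hinge_right diff_divide_distrib right_diff_distrib)
    have "f x = - c * \<epsilon> / (t - \<epsilon>) + c / (t - \<epsilon>) * x"
    proof (rule convex_eq_affine_if_above[OF conv _ 2])
      show "- c * \<epsilon> / (t - \<epsilon>) + c / (t - \<epsilon>) * x \<le> f x"
        using affine[of x] dom[of x] 2 ce \<epsilon> by simp
    qed (use affine eq cn ce \<epsilon>t t in auto)
    then show ?thesis
      using affine[of x] 2 ce by simp
  qed
qed

lemma (in prob_space) expectation_in_unit_interval:
  fixes Y :: "'a \<Rightarrow> real"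
  assumes "AE \<omega> in M. 0 \<le> Y \<omega> \<and> Y \<omega> \<le> 1"
  shows "expectation Y \<in> {0..1}"
proof -
  have "expectation Y \<le> 1"
    \<comment> \<open>A non-integrable function has integral \<open>0\<close> by convention.\<close>
    using assms by (cases "integrable M Y") (auto intro: integral_le_const simp: not_integrable_integral_eq)
  moreover have "0 \<le> expectation Y"
    using assms by (intro integral_nonneg_AE) auto
  ultimately show ?thesis
    by simp
qed

theorem theorem3p4:
  fixes M :: "'a measure" and X :: "nat \<Rightarrow> 'a \<Rightarrow> real" and n :: nat
    and p t :: real and \<phi> :: "real \<Rightarrow> real"
  assumes "prob_space M"
    and "prob_space.indep_vars M (\<lambda>_. borel) X {1..n}"
    and "\<And>i. i \<in> {1..n} \<Longrightarrow> AE \<omega> in M. 0 \<le> X i \<omega> \<and> X i \<omega> \<le> 1"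
    and "p = 1 / real n * (\<Sum>i=1..n. prob_space.expectation M (X i))"
    and "real n * p < t" and "t < real n"
    and "T_minimizer n p t \<phi>"
  shows "\<exists>\<epsilon>\<in>{0..<t}.
           T_minimizer n p t (hinge t \<epsilon>) \<and>
           (\<forall>i\<in>set_pmf (binomial_pmf n p). \<phi> (real i) = \<phi> t * hinge t \<epsilon> (real i)) \<and>
           (0 < p \<longrightarrow> (\<forall>x\<in>{0..real n} - {of_int \<lfloor>\<epsilon>\<rfloor><..<of_int \<lceil>\<epsilon>\<rceil>}.
                       \<phi> x = \<phi> t * hinge t \<epsilon> x))"
proof -
  interpret prob_space M
    by fact
  have p0: "0 \<le> p"
    using expectation_in_unit_interval[OF assms(3)] unfolding assms(4)
    by (intro mult_nonneg_nonneg sum_nonneg) auto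
  then have t0: "0 < t"
    using assms(5) mult_nonneg_nonneg[of "real n" p] by linarith
  have "real n * p < real n * 1"
    using assms(5,6) by simp
  then have p1: "p < 1"
    by (rule mult_left_less_imp_less) simp
  then have p: "p \<in> {0..1}"
    using p0 by simp
  obtain \<epsilon> where \<epsilon>: "\<epsilon> \<in> {0..<t}" and dom: "\<And>x. 0 \<le> x \<Longrightarrow> \<phi> t * hinge t \<epsilon> x \<le> \<phi> x"
    using minimizer_dominates_hinge[OF p t0 assms(5,7)] by blast
  have g: "hinge t \<epsilon> \<in> F_ic t" "hinge t \<epsilon> t = 1"
    using \<epsilon> by (auto simp: hinge_in_F_ic hinge_at)
  note minimizer = minimizer_eq_dominated_on_support[OF p assms(7) g dom]
  have "\<phi> x = \<phi> t * hinge t \<epsilon> x"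
    if "0 < p" "x \<in> {0..real n} - {of_int \<lfloor>\<epsilon>\<rfloor><..<of_int \<lceil>\<epsilon>\<rceil>}" for x
  proof (rule eq_scaled_hinge_off_kink[OF _ \<epsilon> assms(6) dom _ that(2)])
    show "convex_on {0..} \<phi>"
      using assms(7) by (simp add: T_minimizer_def F_ic_def)
    show "\<phi> (real i) = \<phi> t * hinge t \<epsilon> (real i)" if "i \<le> n" for i
    proof (rule minimizer(2))
      show "i \<in> set_pmf (binomial_pmf n p)"
        using that \<open>0 < p\<close> p1 by simp
    qed
  qed
  then show ?thesis
    using \<epsilon> minimizer by blast
qed

end
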